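(* Let $A,B$ be real symmetric positive-definite $2n\times 2n$ matrices. If $[A,B]=0$ and $[JA,JB]=0$, then for all $s\in\mathbb{R}$ the matrices $A^s$ and $B^s$ satisfy $[JA^s,JB^s]=0$.
   Context: $J=J_{2n}=\begin{bmatrix}0_n & I_n\\ -I_n & 0_n\end{bmatrix}$, $[X,Y]=XY-YX$ is the matrix commutator, and $A^s$ denotes the real power of a symmetric positive-definite matrix defined by the spectral theorem. *)

theory Defs
  imports "HOL-Analysis.Analysis"
begin

text \<open>A \<open>2n \<times> 2n\<close> matrix is indexed by the sum type \<open>'n + 'n\<close>, where \<open>n = CARD('n)\<close>:
  \<open>Inl\<close> selects the first \<open>n\<close> rows (columns) and \<open>Inr\<close> the last \<open>n\<close>.\<close>

definition block_matrix ::
  "'a^'n^'m \<Rightarrow> 'a^'k^'m \<Rightarrow> 'a^'n^'l \<Rightarrow> 'a^'k^'l \<Rightarrow> 'a^('n::finite + 'k::finite)^('m::finite + 'l::finite)"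
  where "block_matrix P Q R S = (\<chi> i j.
    case i of
      Inl a \<Rightarrow> (case j of Inl b \<Rightarrow> P $ a $ b | Inr b \<Rightarrow> Q $ a $ b)
    | Inr a \<Rightarrow> (case j of Inl b \<Rightarrow> R $ a $ b | Inr b \<Rightarrow> S $ a $ b))"

definition J_matrix :: "real^('n::finite + 'n)^('n + 'n)"
  where "J_matrix = block_matrix 0 (mat 1) (- mat 1) 0"

definition commutator :: "real^'n^'n \<Rightarrow> real^'n^'n \<Rightarrow> real^'n^'n"
  where "commutator X Y = X ** Y - Y ** X"

definition sym_pos_def :: "real^'n^'n \<Rightarrow> bool"
  where "sym_pos_def A \<longleftrightarrow> transpose A = A \<and> (\<forall>x. x \<noteq> 0 \<longrightarrow> 0 < x \<bullet> (A *v x))"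

definition diagonal :: "real^'n \<Rightarrow> real^'n^'n"
  where "diagonal d = (\<chi> i j. if i = j then d $ i else 0)"

text \<open>If \<open>A = U D U\<^sup>T\<close> with \<open>U\<close> orthogonal and \<open>D\<close> diagonal, then \<open>A\<^sup>s = U D\<^sup>s U\<^sup>T\<close>. For a
  positive-definite \<open>A\<close> all diagonal entries are positive, where \<open>powr\<close> is the usual real power.
  The value does not depend on the diagonalization (lemma \<open>matrix_powr_eq\<close> below), and
  the spectral theorem provides one for every symmetric \<open>A\<close>.\<close>

definition matrix_powr :: "real^'n^'n \<Rightarrow> real \<Rightarrow> real^'n^'n"
  where "matrix_powr A s = (THE X. \<exists>U d. orthogonal_matrix U
    \<and> A = U ** diagonal d ** transpose U
    \<and> X = U ** diagonal (\<chi> i. d $ i powr s) ** transpose U)"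

lemma diagonal_mult_right: "(M ** diagonal d) $ i $ j = M $ i $ j * d $ j"
  by (simp add: matrix_matrix_mult_def diagonal_def if_distrib cong: if_cong)

lemma diagonal_mult_left: "(diagonal d ** M) $ i $ j = d $ i * M $ i $ j"
  by (simp add: matrix_matrix_mult_def diagonal_def if_distrib if_distribR cong: if_cong)

lemma orthogonal_conj_unique:
  fixes U V :: "real^'n^'n"
  assumes U: "orthogonal_matrix U" and V: "orthogonal_matrix V"
    and eq: "U ** diagonal d ** transpose U = V ** diagonal e ** transpose V"
  shows "U ** diagonal (\<chi> i. f (d $ i)) ** transpose U
       = V ** diagonal (\<chi> i. f (e $ i)) ** transpose V"
proof -
  define R where "R = transpose V ** U"
  have UU: "transpose U ** U = mat 1" "U ** transpose U = mat 1"
    and VV: "transpose V ** V = mat 1" "V ** transpose V = mat 1"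
    using U V by (auto simp: orthogonal_matrix_def)
  have "R ** diagonal d = transpose V ** (U ** diagonal d ** transpose U) ** U"
    by (metis R_def UU(1) matrix_mul_assoc matrix_mul_rid)
  also have "\<dots> = diagonal e ** R"
    unfolding eq by (metis R_def VV(1) matrix_mul_assoc matrix_mul_lid)
  finally have "R ** diagonal d = diagonal e ** R" .
  then have "R $ i $ j * d $ j = e $ i * R $ i $ j" for i j
    by (metis diagonal_mult_right diagonal_mult_left)
  then have "R $ i $ j * f (d $ j) = f (e $ i) * R $ i $ j" for i j
    by (metis mult.commute mult_cancel_left)
  then have RR: "R ** diagonal (\<chi> i. f (d $ i)) = diagonal (\<chi> i. f (e $ i)) ** R"
    by (simp add: vec_eq_iff diagonal_mult_right diagonal_mult_left)
  have "U ** diagonal (\<chi> i. f (d $ i)) ** transpose U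
      = V ** (R ** diagonal (\<chi> i. f (d $ i))) ** transpose U"
    by (metis R_def VV(2) matrix_mul_assoc matrix_mul_lid)
  also have "\<dots> = V ** diagonal (\<chi> i. f (e $ i)) ** transpose V"
    unfolding RR by (metis R_def UU(2) matrix_mul_assoc matrix_mul_rid)
  finally show ?thesis .
qed

lemma matrix_powr_eq:
  fixes A U :: "real^'n^'n"
  assumes "orthogonal_matrix U" and "A = U ** diagonal d ** transpose U"
  shows "matrix_powr A s = U ** diagonal (\<chi> i. d $ i powr s) ** transpose U"
  unfolding matrix_powr_def
proof (rule the_equality)
  show "\<exists>U' d'. orthogonal_matrix U' \<and> A = U' ** diagonal d' ** transpose U'
    \<and> U ** diagonal (\<chi> i. d $ i powr s) ** transpose U
      = U' ** diagonal (\<chi> i. d' $ i powr s) ** transpose U'"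
    using assms by blast
next
  fix X
  assume "\<exists>U' d'. orthogonal_matrix U' \<and> A = U' ** diagonal d' ** transpose U'
    \<and> X = U' ** diagonal (\<chi> i. d' $ i powr s) ** transpose U'"
  then obtain U' d' where U': "orthogonal_matrix U'" "A = U' ** diagonal d' ** transpose U'"
    and X: "X = U' ** diagonal (\<chi> i. d' $ i powr s) ** transpose U'"
    by blast
  show "X = U ** diagonal (\<chi> i. d $ i powr s) ** transpose U"
    unfolding X
    by (rule orthogonal_conj_unique[OF U'(1) assms(1), where f = "\<lambda>x. x powr s"])
      (use U'(2) assms(2) in simp)
qed

end

theory Submission
  imports Defs
begin

text \<open>Commuting symmetric matrices \<open>A\<close> and \<open>B\<close> have a common orthonormal eigenbasis, with
  eigenvalues \<open>a\<^sub>i\<close> and \<open>b\<^sub>i\<close>. If \<open>K\<close> is the matrix \<open>J\<close> in this basis, then \<open>A J B = B J A\<close> reads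
  \<open>a\<^sub>i K\<^sub>i\<^sub>j b\<^sub>j = b\<^sub>i K\<^sub>i\<^sub>j a\<^sub>j\<close>, that is, \<open>a\<^sub>i b\<^sub>j = b\<^sub>i a\<^sub>j\<close> whenever \<open>K\<^sub>i\<^sub>j \<noteq> 0\<close>. For
  positive eigenvalues this condition is preserved by taking powers.\<close>

text \<open>Variational argument: the form \<open>x \<bullet> f x\<close> attains a maximum
  \<open>c\<close> on the compact unit sphere of \<open>S\<close>. Moving a maximizer
  \<open>v\<close> along the residual \<open>f v - c *\<^sub>R v\<close> would increase the form to
  first order unless the residual is zero.\<close>

lemma selfadjoint_eigenvector_exists:
  fixes f :: "'a::euclidean_space \<Rightarrow> 'a"
  assumes f: "linear f" and sym: "\<And>x y. f x \<bullet> y = x \<bullet> f y"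
    and S: "subspace S" "f ` S \<subseteq> S" "S \<noteq> {0}"
  obtains v c where "v \<in> S" "norm v = 1" "f v = c *\<^sub>R v"
proof -
  let ?K = "sphere 0 1 \<inter> S"
  obtain u where u: "u \<in> S" "u \<noteq> 0" using S subspace_0 by blast
  have "compact ?K" using closed_subspace[OF S(1)] by (simp add: compact_Int_closed)
  moreover have "(1 / norm u) *\<^sub>R u \<in> ?K" using u S(1) by (simp add: subspace_scale)
  moreover have "continuous_on ?K (\<lambda>x. x \<bullet> f x)"
    by (intro continuous_intros linear_continuous_on linear_linear[THEN iffD2] f)
  ultimately obtain v where v: "v \<in> ?K" "\<And>x. x \<in> ?K \<Longrightarrow> x \<bullet> f x \<le> v \<bullet> f v"
    using continuous_attains_sup[of ?K "\<lambda>x. x \<bullet> f x"] by blast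
  define c where "c = v \<bullet> f v"
  have vv: "v \<bullet> v = 1" using v(1) by (simp add: dot_square_norm)
  have le: "x \<bullet> f x \<le> c * (x \<bullet> x)" if "x \<in> S" for x
  proof (cases "x = 0")
    case False
    have "(1 / norm x) *\<^sub>R x \<in> ?K" using that S(1) False by (simp add: subspace_scale)
    from v(2)[OF this] have "x \<bullet> f x / (norm x)\<^sup>2 \<le> c"
      by (simp add: c_def linear_scale[OF f] power2_eq_square)
    then show ?thesis using False by (simp add: field_simps dot_square_norm)
  qed (simp add: linear_0[OF f])
  define g where "g = f v - c *\<^sub>R v"
  have gS: "g \<in> S" using v(1) S by (auto simp: g_def intro!: subspace_diff subspace_scale)
  define q where "q = g \<bullet> g"
  \<comment> \<open>\<open>M\<close> is the second-order coefficient in the expansion of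
    \<open>le\<close> at \<open>v + t *\<^sub>R g\<close>; the first-order coefficient is
    \<open>2 * q\<close>.\<close>
  define M where "M = c * q - g \<bullet> f g"
  have M: "M \<ge> 0" using le[OF gS] by (simp add: M_def q_def)
  have gv: "g \<bullet> f v = q + c * (g \<bullet> v)" by (simp add: g_def q_def algebra_simps)
  have step: "2 * t * q \<le> t\<^sup>2 * M" for t
  proof -
    have "v + t *\<^sub>R g \<in> S" using v(1) gS S(1) by (simp add: subspace_add subspace_scale)
    from le[OF this]
    have "c + 2 * t * (g \<bullet> f v) + t\<^sup>2 * (g \<bullet> f g) \<le> c * (1 + 2 * t * (g \<bullet> v) + t\<^sup>2 * q)"
      using sym[of v g] by (simp add: linear_add[OF f] linear_scale[OF f] inner_add_left
        inner_add_right c_def[symmetric] vv q_def[symmetric] power2_eq_square inner_commute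
        algebra_simps)
    then show ?thesis by (simp add: M_def gv algebra_simps)
  qed
  have "q = 0"
  proof (rule ccontr)
    assume "q \<noteq> 0"
    then have q: "q > 0" by (simp add: q_def)
    \<comment> \<open>A step size small enough that \<open>r * M \<le> q\<close>, against
      \<open>2 * q \<le> r * M\<close> from \<open>step\<close>; the \<open>+ 1\<close> keeps the
      denominator positive when \<open>M = 0\<close>.\<close>
    define r where "r = q / (M + 1)"
    have r: "r > 0" using q M by (simp add: r_def)
    have "r * (2 * q) \<le> r * (r * M)"
      using step[of r] by (simp add: power2_eq_square algebra_simps)
    then have "2 * q \<le> r * M" using r by (simp only: mult_le_cancel_left_pos)
    also have "\<dots> \<le> q" using q M by (simp add: r_def field_simps)
    finally show False using q by simp
  qed
  then have "f v = c *\<^sub>R v" by (simp add: q_def g_def)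
  with v(1) show thesis using that[of v c] by simp
qed

text \<open>Induction on \<open>dim S\<close>: split off one common unit eigenvector and apply the
  hypothesis to its orthogonal complement within \<open>S\<close>.\<close>

lemma commuting_selfadjoint_eigenbasis:
  fixes f g :: "'a::euclidean_space \<Rightarrow> 'a"
  assumes f: "linear f" "\<And>x y. f x \<bullet> y = x \<bullet> f y"
    and g: "linear g" "\<And>x y. g x \<bullet> y = x \<bullet> g y"
    and comm: "\<And>x. f (g x) = g (f x)"
    and S: "subspace S" "f ` S \<subseteq> S" "g ` S \<subseteq> S"
  shows "\<exists>E. span E = S \<and> pairwise orthogonal E
    \<and> (\<forall>v\<in>E. norm v = 1 \<and> (\<exists>a. f v = a *\<^sub>R v) \<and> (\<exists>b. g v = b *\<^sub>R v))"
  using S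
proof (induction "dim S" arbitrary: S rule: less_induct)
  case less
  show ?case
  proof (cases "S = {0}")
    case True
    then show ?thesis by (intro exI[of _ "{}"]) simp
  next
    case False
    obtain u a where u: "u \<in> S" "norm u = 1" "f u = a *\<^sub>R u"
      by (rule selfadjoint_eigenvector_exists[OF f less.prems(1,2) False])
    \<comment> \<open>An eigenspace of \<open>f\<close>, invariant under \<open>g\<close> because
      the maps commute. Any eigenvector of \<open>g\<close> found inside it is a common one;
      \<open>u\<close> only witnesses that \<open>T\<close> is nonzero.\<close>
    define T where "T = {x \<in> S. f x = a *\<^sub>R x}"
    have "subspace T"
      by (rule subspaceI) (use less.prems(1) in \<open>simp_all add: T_def linear_0[OF f(1)]
        linear_add[OF f(1)] linear_scale[OF f(1)] scaleR_add_right subspace_0 subspace_add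
        subspace_scale\<close>)
    moreover have "g ` T \<subseteq> T" using less.prems(3)
      by (auto simp: T_def comm linear_scale[OF g(1)])
    moreover have "u \<in> T" "u \<noteq> 0" using u by (simp add: T_def, force)
    then have "T \<noteq> {0}" by blast
    ultimately obtain v b where "v \<in> T" and v: "norm v = 1" "g v = b *\<^sub>R v"
      by (rule selfadjoint_eigenvector_exists[OF g])
    then have vS: "v \<in> S" and fv: "f v = a *\<^sub>R v" by (auto simp: T_def)
    define S' where "S' = {x \<in> S. v \<bullet> x = 0}"
    have vv: "v \<bullet> v = 1" using v(1) by (simp add: dot_square_norm)
    have sub: "subspace S'"
      by (rule subspaceI) (use less.prems(1) in \<open>simp_all add: S'_def inner_add_right subspace_0
        subspace_add subspace_scale\<close>)
    \<comment> \<open>Self-adjointness moves each map onto the eigenvector: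
      \<open>v \<bullet> f x = f v \<bullet> x = a * (v \<bullet> x) = 0\<close>, and likewise for
      \<open>g\<close>.\<close>
    have "f ` S' \<subseteq> S'" "g ` S' \<subseteq> S'"
      using less.prems(2,3) by (auto simp: S'_def fv v(2) simp flip: f(2) g(2))
    moreover have "S' \<subseteq> S" "v \<notin> S'" using vv by (auto simp: S'_def)
    then have "S' \<subset> S" using vS by blast
    then have "dim S' < dim S"
      using sub less.prems(1) by (intro dim_psubset) (simp add: span_eq_iff[THEN iffD2])
    ultimately obtain E where E: "span E = S'" "pairwise orthogonal E"
      "\<forall>v\<in>E. norm v = 1 \<and> (\<exists>a. f v = a *\<^sub>R v) \<and> (\<exists>b. g v = b *\<^sub>R v)"
      using less.hyps[OF _ sub] by blast
    have ES: "E \<subseteq> S'" using E(1) span_superset by blast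
    have "span (insert v E) = S"
    proof
      show "span (insert v E) \<subseteq> S"
        using ES vS less.prems(1) by (intro span_minimal) (auto simp: S'_def)
      show "S \<subseteq> span (insert v E)"
      proof
        fix x assume x: "x \<in> S"
        have "x - (v \<bullet> x) *\<^sub>R v \<in> S'" using x vS less.prems(1)
          by (auto simp: S'_def inner_diff_right vv intro!: subspace_diff subspace_scale)
        then show "x \<in> span (insert v E)" unfolding span_insert E(1) by blast
      qed
    qed
    moreover have "pairwise orthogonal (insert v E)"
      using E(2) ES by (auto simp: pairwise_insert S'_def orthogonal_def inner_commute)
    ultimately show ?thesis using E(3) v fv by (intro exI[of _ "insert v E"]) auto
  qed
qed

lemma matrix_eigen_columns:
  fixes A U :: "real^'n^'n"
  assumes U: "orthogonal_matrix U" and eig: "\<And>j. A *v column j U = d $ j *\<^sub>R column j U"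
  shows "A = U ** diagonal d ** transpose U"
proof -
  have "(A ** U) $ i $ j = (U ** diagonal d) $ i $ j" for i j
  proof -
    have "(A ** U) $ i $ j = (A *v column j U) $ i"
      by (simp add: matrix_matrix_mult_def matrix_vector_mult_def column_def)
    then show ?thesis by (simp only: eig) (simp add: diagonal_mult_right column_def)
  qed
  then have "A ** U = U ** diagonal d" by (simp add: vec_eq_iff)
  then show ?thesis
    using U by (metis matrix_mul_assoc matrix_mul_rid orthogonal_matrix_def)
qed

text \<open>The common orthonormal eigenbasis of the whole space has as many elements as the index
  type, so it can be enumerated by that type and taken as the columns of \<open>U\<close>.\<close>

lemma simultaneous_diagonalization:
  fixes A B :: "real^'n^'n"
  assumes A: "transpose A = A" and B: "transpose B = B" and comm: "A ** B = B ** A"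
  obtains U a b where "orthogonal_matrix U"
    "A = U ** diagonal a ** transpose U" "B = U ** diagonal b ** transpose U"
proof -
  have adj: "(M *v x) \<bullet> y = x \<bullet> (M *v y)" if "transpose M = M" for M :: "real^'n^'n" and x y
    by (metis dot_lmul_matrix that vector_transpose_matrix)
  obtain E :: "(real^'n) set" where E: "span E = UNIV" "pairwise orthogonal E"
    and eig: "\<forall>v\<in>E. norm v = 1 \<and> (\<exists>a. A *v v = a *\<^sub>R v) \<and> (\<exists>b. B *v v = b *\<^sub>R v)"
    using commuting_selfadjoint_eigenbasis[of "(*v) A" "(*v) B" UNIV] adj[OF A] adj[OF B] comm
    by (auto simp: matrix_vector_mul_assoc)
  have ind: "independent E" using E(2) eig by (intro pairwise_orthogonal_independent) auto
  have "card E = CARD('n)" using dim_eq_card[OF _ ind, of UNIV] E(1) by simp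
  then obtain h :: "'n \<Rightarrow> real^'n" where h: "bij_betw h UNIV E"
    using finite_same_card_bij[of "UNIV :: 'n set" E] independent_imp_finite[OF ind] by auto
  have hE: "h j \<in> E" for j using h by (auto simp: bij_betw_def)
  have "\<forall>j. \<exists>a b. A *v h j = a *\<^sub>R h j \<and> B *v h j = b *\<^sub>R h j"
    using eig hE by blast
  then obtain a b where ab: "\<And>j. A *v h j = a j *\<^sub>R h j" "\<And>j. B *v h j = b j *\<^sub>R h j"
    unfolding choice_iff by blast
  define U where "U = (\<chi> i j. h j $ i)"
  have col: "column j U = h j" for j by (simp add: U_def column_def vec_eq_iff)
  have "h i \<noteq> h j" if "i \<noteq> j" for i j
    using h that by (auto simp: bij_betw_def inj_def)
  then have "orthogonal (h i) (h j)" if "i \<noteq> j" for i j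
    using E(2) hE that by (simp add: pairwise_def)
  then have U: "orthogonal_matrix U"
    using eig hE by (simp add: orthogonal_matrix_orthonormal_columns col)
  show thesis
    by (rule that[OF U, of "\<chi> j. a j" "\<chi> j. b j"]; rule matrix_eigen_columns[OF U])
      (simp_all add: col ab)
qed

text \<open>The quadratic form of \<open>A\<close> takes the value \<open>d $ i\<close> at column
  \<open>i\<close> of \<open>U\<close>, which is the vector \<open>U *v axis i 1\<close>.\<close>

lemma sym_pos_def_eigenvalue_pos:
  fixes A U :: "real^'n^'n"
  assumes A: "sym_pos_def A" and U: "orthogonal_matrix U"
    and AU: "A = U ** diagonal d ** transpose U"
  shows "d $ i > 0"
proof -
  have UU: "transpose U ** U = mat 1" using U by (simp add: orthogonal_matrix_def)
  define v where "v = U *v axis i 1"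
  have tv: "transpose U *v v = axis i 1"
    by (simp add: v_def matrix_vector_mul_assoc UU)
  then have "v \<noteq> 0" by (auto simp: axis_eq_0_iff)
  then have "0 < v \<bullet> (A *v v)" using A by (simp add: sym_pos_def_def)
  also have "\<dots> = (transpose U *v v) \<bullet> (diagonal d *v (transpose U *v v))"
    by (simp add: AU dot_lmul_matrix vector_transpose_matrix flip: matrix_vector_mul_assoc)
  also have "\<dots> = d $ i"
    unfolding tv by (simp add: inner_axis' matrix_vector_mul_component diagonal_def inner_axis)
  finally show ?thesis .
qed

text \<open>Conjugation by \<open>U\<close> is injective, so the identity may be compared entrywise
  in the eigenbasis. As an equivalence for arbitrary diagonals, it serves both to read off the
  hypothesis on \<open>A\<close> and \<open>B\<close> and to establish the conclusion for their
  powers.\<close>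

lemma diagonal_conj_swap_iff:
  fixes J U :: "real^'n^'n"
  assumes U: "orthogonal_matrix U"
  shows "U ** diagonal a ** transpose U ** J ** (U ** diagonal b ** transpose U)
       = U ** diagonal b ** transpose U ** J ** (U ** diagonal a ** transpose U)
    \<longleftrightarrow> (\<forall>i j. a $ i * (transpose U ** J ** U) $ i $ j * b $ j
             = b $ i * (transpose U ** J ** U) $ i $ j * a $ j)"
    (is "?L a b = ?L b a \<longleftrightarrow> _")
proof -
  define K where "K = transpose U ** J ** U"
  have UU: "transpose U ** U = mat 1" "U ** transpose U = mat 1"
    using U by (auto simp: orthogonal_matrix_def)
  have L: "?L p q = U ** (diagonal p ** K ** diagonal q) ** transpose U" for p q
    by (simp add: K_def matrix_mul_assoc)
  have "U ** X ** transpose U = U ** Y ** transpose U \<longleftrightarrow> X = Y" for X Y :: "real^'n^'n"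
    by (metis UU(1) matrix_mul_assoc matrix_mul_lid matrix_mul_rid)
  then show ?thesis
    unfolding L K_def[symmetric] by (simp add: vec_eq_iff diagonal_mult_right diagonal_mult_left)
qed

lemma J_matrix_square: "J_matrix ** J_matrix = - (mat 1 :: real^('n::finite + 'n)^('n + 'n))"
proof -
  have "(J_matrix ** J_matrix) $ i $ j = (- mat 1 :: real^('n + 'n)^('n + 'n)) $ i $ j" for i j
    \<comment> \<open>One case per block; \<open>sum.Plus\<close> splits the summation over the sum
      type into its two halves.\<close>
    by (cases i; cases j)
      (simp_all add: matrix_matrix_mult_def J_matrix_def block_matrix_def mat_def UNIV_Plus_UNIV[symmetric]
        sum.Plus if_distrib if_distribR cong: if_cong del: UNIV_Plus_UNIV)
  then show ?thesis by (simp add: vec_eq_iff)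
qed

text \<open>Both products in the commutator begin with \<open>J_matrix\<close>, which can be
  cancelled since its square is \<open>- mat 1\<close>.\<close>

lemma commutator_J_iff:
  fixes A B :: "real^('n::finite + 'n)^('n + 'n)"
  shows "commutator (J_matrix ** A) (J_matrix ** B) = 0
    \<longleftrightarrow> A ** J_matrix ** B = B ** J_matrix ** A"
proof -
  have "(- mat 1) ** X = - X" for X :: "real^('n + 'n)^('n + 'n)"
    by (simp add: vec_eq_iff matrix_matrix_mult_def mat_def if_distrib if_distribR cong: if_cong)
  then have "J_matrix ** X = J_matrix ** Y \<longleftrightarrow> X = Y" for X Y :: "real^('n + 'n)^('n + 'n)"
    by (metis J_matrix_square matrix_mul_assoc neg_equal_iff_equal)
  then show ?thesis by (simp add: commutator_def flip: matrix_mul_assoc)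
qed

theorem theorem3p8:
  fixes A B :: "real^('n::finite + 'n)^('n + 'n)"
  assumes "sym_pos_def A" and "sym_pos_def B"
    and "commutator A B = 0"
    and "commutator (J_matrix ** A) (J_matrix ** B) = 0"
  shows "\<forall>s::real. commutator (J_matrix ** matrix_powr A s) (J_matrix ** matrix_powr B s) = 0"
proof
  fix s :: real
  have "transpose A = A" "transpose B = B" "A ** B = B ** A"
    using assms(1-3) by (auto simp: sym_pos_def_def commutator_def)
  then obtain U a b where U: "orthogonal_matrix U"
    and A: "A = U ** diagonal a ** transpose U" and B: "B = U ** diagonal b ** transpose U"
    by (rule simultaneous_diagonalization)
  define K where "K = transpose U ** J_matrix ** U"
  have pos: "a $ i > 0" "b $ i > 0" for i
    using sym_pos_def_eigenvalue_pos[OF assms(1) U A] sym_pos_def_eigenvalue_pos[OF assms(2) U B]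
    by auto
  have eq: "a $ i * K $ i $ j * b $ j = b $ i * K $ i $ j * a $ j" for i j
    using assms(4)[unfolded commutator_J_iff, unfolded A B diagonal_conj_swap_iff[OF U]]
    by (simp add: K_def)
  have "a $ i powr s * K $ i $ j * b $ j powr s = b $ i powr s * K $ i $ j * a $ j powr s" for i j
  proof (cases "K $ i $ j = 0")
    case False
    \<comment> \<open>A nonzero \<open>K $ i $ j\<close> cancels, leaving an equation between
      products of positive numbers, over which \<open>powr s\<close> distributes.\<close>
    then have "a $ i * b $ j = b $ i * a $ j" using eq[of i j] by simp
    then have "a $ i powr s * b $ j powr s = b $ i powr s * a $ j powr s"
      using pos by (metis powr_mult)
    then show ?thesis by simp
  qed simp
  then show "commutator (J_matrix ** matrix_powr A s) (J_matrix ** matrix_powr B s) = 0"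
    unfolding commutator_J_iff matrix_powr_eq[OF U A] matrix_powr_eq[OF U B]
      diagonal_conj_swap_iff[OF U]
    by (simp add: K_def)
qed

end
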